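(* Let $f_k=\prod_{j=1}^{\infty}(1-q^{kj})$ and let $p_8(n)$ be defined by $\sum_{n\ge0}p_8(n)q^n=1/f_1^8$. Define the infinite matrix $M=(m_{j,k})_{j,k\ge1}$ by: $m_{1,1}=8$, $m_{1,k}=0$ for $k\ge2$; $m_{2,1}=1$, $m_{2,2}=128$, $m_{2,k}=0$ for $k\ge3$; $m_{j,1}=0$ for $j\ge3$; and $m_{j,k}=16m_{j-1,k-1}+m_{j-2,k-1}$ for $j\ge3$, $k\ge2$. Define the infinite matrix $(x_{\alpha,j})_{\alpha,j\ge1}$ by $x_{1,1}=8$, $x_{1,k}=0$ for $k\ge2$, and \[x_{\alpha+1,j}=\begin{cases}\sum_{i=1}^{\infty}x_{\alpha,i}\,m_{3i,i+j} & \text{if } \alpha \text{ is odd},\\ \sum_{i=1}^{\infty}x_{\alpha,i}\,m_{3i+1,i+j} & \text{if } \alpha \text{ is even}.\end{cases}\] Then for every positive integer $\alpha$, \[\sum_{n=0}^{\infty} p_8\!\left(2^{2\alpha-1}n + \tfrac{2^{2\alpha-1}+1}{3}\right)q^{n+1}=\frac{1}{f_2^8}\sum_{j=1}^{(4^{\alpha}-1)/3}x_{2\alpha-1,j}\, q^j \frac{f_2^{24j}}{f_1^{24j}}\] and \[\sum_{n=0}^{\infty} p_8\!\left(2^{2\alpha}n + \tfrac{2^{2\alpha+1}+1}{3}\right)q^{n+1}=\frac{1}{f_1^8}\sum_{j=1}^{2(4^{\alpha}-1)/3}x_{2\alpha,j}\, q^j \frac{f_2^{24j}}{f_1^{24j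}}.\]
   Context: The sums defining $x_{\alpha+1,j}$ have only finitely many nonzero terms. *)

theory Defs
  imports "HOL-Analysis.Analysis" "HOL-Computational_Algebra.Formal_Power_Series"
begin

text \<open>The infinite product is taken in the metric topology of formal power series.\<close>

definition euler_f :: "nat \<Rightarrow> rat fps" where
  "euler_f k = (\<Prod>j. 1 - fps_X ^ (k * (j + 1)))"

definition p8 :: "nat \<Rightarrow> rat" where
  "p8 n = fps_nth (1 / euler_f 1 ^ 8) n"

text \<open>The matrices are indexed from 1; entries with a zero index are unused filler.\<close>

fun m_entry :: "nat \<Rightarrow> nat \<Rightarrow> int" where
  "m_entry (Suc 0) k = (if k = 1 then 8 else 0)"
| "m_entry (Suc (Suc 0)) k = (if k = 1 then 1 else if k = 2 then 128 else 0)"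
| "m_entry (Suc (Suc (Suc j))) (Suc (Suc k)) =
     16 * m_entry (Suc (Suc j)) (Suc k) + m_entry (Suc j) (Suc k)"
| "m_entry _ _ = 0"

fun x_entry :: "nat \<Rightarrow> nat \<Rightarrow> int" where
  "x_entry 0 j = 0"
| "x_entry (Suc 0) j = (if j = 1 then 8 else 0)"
| "x_entry (Suc (Suc a)) j =
     (if odd (Suc a)
      then (\<Sum>\<^sub>\<infinity>i\<in>{1..}. x_entry (Suc a) i * m_entry (3 * i) (i + j))
      else (\<Sum>\<^sub>\<infinity>i\<in>{1..}. x_entry (Suc a) i * m_entry (3 * i + 1) (i + j)))"

text \<open>Well-definedness: the product converges and the sums have finite support.\<close>

lemma euler_f_has_prod:
  assumes "k > 0"
  shows "(\<lambda>j. 1 - fps_X ^ (k * (j + 1))) has_prod euler_f k"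
proof -
  let ?F = "\<lambda>j. 1 - fps_X ^ (k * (j + 1)) :: rat fps"
  let ?P = "\<lambda>n. \<Prod>i\<le>n. ?F i"
  have stab: "fps_nth (?P n) i = fps_nth (?P i) i" if "i \<le> n" for i n
    using that
  proof (induction n rule: dec_induct)
    case (step n)
    have "1 * (Suc n + 1) \<le> k * (Suc n + 1)"
      using assms by (intro mult_le_mono) auto
    moreover have "i < 1 * (Suc n + 1)" using step.hyps by simp
    ultimately have "i < k * (Suc n + 1)" by (rule less_le_trans[rotated])
    then have "fps_nth (?P n * fps_X ^ (k * (Suc n + 1))) i = 0"
      by (simp add: fps_X_power_mult_right_nth del: fps_X_power_mult_nth mult_Suc_right)
    then have "fps_nth (?P n - ?P n * fps_X ^ (k * (Suc n + 1))) i = fps_nth (?P n) i"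
      unfolding fps_sub_nth by (rule ssubst) (rule diff_zero)
    moreover have "?P (Suc n) = ?P n - ?P n * fps_X ^ (k * (Suc n + 1))"
      unfolding prod.atMost_Suc right_diff_distrib mult_1_right ..
    ultimately show ?case unfolding step.IH[symmetric] by (rule ssubst[rotated])
  qed simp
  define L where "L = Abs_fps (\<lambda>i. fps_nth (?P i) i)"
  have "?P \<longlonglongrightarrow> L"
  proof (rule tendsto_fpsI)
    fix i
    show "\<forall>\<^sub>F n in sequentially. fps_nth (?P n) i = fps_nth L i"
      unfolding L_def fps_nth_Abs_fps
      by (rule eventually_sequentiallyI[of i]) (rule stab)
  qed
  moreover have "fps_nth L 0 = 1"
    using assms by (simp add: L_def)
  then have "L \<noteq> 0" by auto
  ultimately have "?F has_prod L"
    by (simp add: has_prod_def raw_has_prod_def)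
  then show ?thesis
    unfolding euler_f_def by (metis has_prod_unique)
qed

lemma m_entry_eq_0: "2 * k < j \<Longrightarrow> m_entry j k = 0"
  by (induction j k rule: m_entry.induct) auto

lemma finite_support_odd:
  "finite {i\<in>{1..}. x_entry a i * m_entry (3 * i) (i + j) \<noteq> 0}"
proof (rule finite_subset)
  show "{i\<in>{1..}. x_entry a i * m_entry (3 * i) (i + j) \<noteq> 0} \<subseteq> {..2 * j}"
  proof
    fix i assume "i \<in> {i\<in>{1..}. x_entry a i * m_entry (3 * i) (i + j) \<noteq> 0}"
    then have "\<not> 2 * (i + j) < 3 * i" using m_entry_eq_0 by auto
    then show "i \<in> {..2 * j}" by simp
  qed
qed simp

lemma finite_support_even:
  "finite {i\<in>{1..}. x_entry a i * m_entry (3 * i + 1) (i + j) \<noteq> 0}"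
proof (rule finite_subset)
  show "{i\<in>{1..}. x_entry a i * m_entry (3 * i + 1) (i + j) \<noteq> 0} \<subseteq> {..2 * j}"
  proof
    fix i assume "i \<in> {i\<in>{1..}. x_entry a i * m_entry (3 * i + 1) (i + j) \<noteq> 0}"
    then have "\<not> 2 * (i + j) < 3 * i + 1" using m_entry_eq_0 by auto
    then show "i \<in> {..2 * j}" by simp
  qed
qed simp

end

theory Submission
  imports Defs
begin

text \<open>
  Write \<open>\<xi> = q f\<^sub>2\<^sup>2\<^sup>4 / f\<^sub>1\<^sup>2\<^sup>4\<close> and \<open>\<zeta> = q f\<^sub>4\<^sup>8 / f\<^sub>1\<^sup>8\<close>, and let \<open>U\<close> map \<open>\<Sum> a(n) q\<^sup>n\<close>
  to \<open>\<Sum> a(2n) q\<^sup>n\<close>. Jacobi's identity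
  \<open>f\<^sub>2\<^sup>2\<^sup>4 = f\<^sub>1\<^sup>1\<^sup>6 f\<^sub>4\<^sup>8 + 16 q f\<^sub>1\<^sup>8 f\<^sub>4\<^sup>1\<^sup>6\<close> says that
  \<open>\<zeta>(q)\<close> and \<open>\<zeta>(-q)\<close> are the roots of \<open>z\<^sup>2 = 16 \<xi>(q\<^sup>2) z + \<xi>(q\<^sup>2)\<close>. Hence
  \<open>U(\<zeta>\<^sup>j)\<close> satisfies the recurrence of the matrix \<open>M\<close>: it equals \<open>\<Sum>\<^sub>k m\<^sub>j\<^sub>k \<xi>\<^sup>k\<close>. Since
  \<open>\<xi>(q) \<xi>(q\<^sup>2) = \<zeta>\<^sup>3\<close>, this computes \<open>U(\<xi>\<^sup>i)\<close> and \<open>U(\<zeta> \<xi>\<^sup>i)\<close>, and the two cases of the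
  recursion for \<open>x\<close> are exactly the two alternating applications of \<open>U\<close>.

  Jacobi's identity follows from \<open>\<phi>(q) = \<phi>(q\<^sup>4) + 2 q \<psi>(q\<^sup>8)\<close> for
  \<open>\<phi> = \<Sum>\<^sub>n\<^sub>\<in>\<^sub>\<int> q^(n\<^sup>2)\<close>, \<open>\<psi> = \<Sum>\<^sub>n\<^sub>\<ge>\<^sub>0 q^(n(n+1)/2)\<close> and Gauss's product formulas for
  \<open>\<phi>\<close> and \<open>\<psi>\<close>, which are limits of finite identities in the style of Shanks.
\<close>

section \<open>Finite forms of Gauss's identities\<close>

text \<open>Each correction term contains q^((s+1)(n+1)), so it disappears in the limit and Gauss's
  formula for \<open>phi\<close> at -q remains. The induction works because
  \<open>t (Suc n) s - (1 + Q) * t n s\<close> telescopes in s.\<close>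

lemma gauss_square_finite:
  fixes q :: "'a :: comm_ring_1"
  shows "(\<Prod>k<n. 1 + q ^ Suc k) * (1 + 2 * (\<Sum>k<n. (-1) ^ Suc k * q ^ (Suc k)\<^sup>2)) =
    (\<Prod>k<n. 1 - q ^ Suc k) +
    2 * (\<Sum>s<n. (-1) ^ Suc s * (\<Prod>k=Suc s..<n. 1 - q ^ Suc k) *
      (\<Prod>k<s. 1 + q ^ Suc k) * q ^ (Suc s * Suc n))"
proof (induction n)
  case (Suc n)
  define D where "D s = (\<Prod>k<s. 1 + q ^ Suc k)" for s
  define g where "g m s = (\<Prod>k=s..<m. 1 - q ^ Suc k)" for m s
  define S where "S m = 1 + 2 * (\<Sum>k<m. (-1) ^ Suc k * q ^ (Suc k)\<^sup>2)" for m
  define t where "t m s = (-1) ^ Suc s * g m (Suc s) * D s * q ^ (Suc s * Suc m)" for m s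
  \<comment> \<open>Telescoping certificate. Its end \<open>B 0\<close> turns the factor 1 - Q of
    \<open>g (Suc n) 0\<close> into 1 + Q; its end \<open>B n\<close> and the last summand together
    account for the new square term.\<close>
  define B where "B s = (-1) ^ s * g n s * D s * q ^ (Suc s * Suc n)" for s
  define Q where "Q = q ^ Suc n"
  have D_Suc: "D (Suc s) = D s * (1 + q ^ Suc s)" for s
    by (simp add: D_def)
  have g_Suc: "g (Suc n) s = g n s * (1 - Q)" if "s \<le> n" for s
    using that by (simp add: g_def Q_def)
  have g_step: "g n s = (1 - q ^ Suc s) * g n (Suc s)" if "s < n" for s
    using that by (simp add: g_def prod.atLeast_Suc_lessThan)
  have g_self: "g m m = 1" for m by (simp add: g_def)
  have step: "t (Suc n) s = (1 + Q) * t n s + (B s - B (Suc s))" if "s < n" for s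
  proof -
    define u where "u = (-1) ^ s * g n (Suc s) * D s * q ^ (Suc s * Suc n)"
    have "q ^ (Suc s * Suc (Suc n)) = q ^ (Suc s * Suc n) * q ^ Suc s"
      unfolding power_add[symmetric] by (simp add: algebra_simps)
    then have "t (Suc n) s = - (u * (1 - Q) * q ^ Suc s)"
      using that by (simp add: t_def u_def g_Suc algebra_simps)
    moreover have "t n s = - u" by (simp add: t_def u_def)
    moreover have "B s = (1 - q ^ Suc s) * u"
      using that by (simp add: B_def u_def g_step[of s] algebra_simps)
    moreover have "q ^ (Suc (Suc s) * Suc n) = q ^ (Suc s * Suc n) * Q"
      unfolding Q_def power_add[symmetric] by (simp add: algebra_simps)
    then have "B (Suc s) = - (u * (1 + q ^ Suc s) * Q)"
      by (simp add: B_def u_def D_Suc algebra_simps)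
    ultimately show ?thesis by (simp only:) (simp add: algebra_simps)
  qed
  have sum: "(\<Sum>s<n. t (Suc n) s) = (1 + Q) * (\<Sum>s<n. t n s) + (B 0 - B n)"
    by (simp add: step sum.distrib sum_distrib_left sum_lessThan_telescope')
  define R where "R = (-1) ^ n * D n * q ^ (Suc n)\<^sup>2"
  have "q ^ (Suc n * Suc (Suc n)) = q ^ (Suc n)\<^sup>2 * Q"
    unfolding Q_def power_add[symmetric] by (simp add: power2_eq_square algebra_simps)
  then have last: "t (Suc n) n = - (R * Q)"
    by (simp add: t_def g_self R_def)
  have Bn: "B n = R"
    by (simp add: B_def g_self power2_eq_square R_def)
  have B0: "B 0 = g n 0 * Q" by (simp add: B_def D_def Q_def)
  have IH: "D n * S n = g n 0 + 2 * (\<Sum>s<n. t n s)"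
    using Suc.IH by (simp add: D_def S_def g_def t_def atLeast0LessThan)
  have "S (Suc n) = S n - 2 * ((-1) ^ n * q ^ (Suc n)\<^sup>2)"
    by (simp add: S_def algebra_simps)
  then have "D (Suc n) * S (Suc n) = (1 + Q) * (D n * S n) - 2 * (1 + Q) * R"
    by (simp only: D_Suc Q_def[symmetric] R_def) (simp add: algebra_simps)
  also have "\<dots> = g (Suc n) 0 + 2 * (\<Sum>s<Suc n. t (Suc n) s)"
    unfolding IH sum.lessThan_Suc sum last Bn B0 g_Suc[OF le0] by (simp add: algebra_simps)
  finally show ?case
    by (simp only: D_def S_def g_def t_def atLeast0LessThan)
qed simp

text \<open>In the limit only s = 0 survives, leaving the product of the 1 - q^(2k): this is Gauss's
  formula for \<open>psi\<close>. The telescoping is as before, with multiplier 1 - Q and with a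
  certificate that vanishes at s = 0.\<close>

lemma gauss_triangular_finite:
  fixes q :: "'a :: comm_ring_1"
  shows "(\<Prod>k<n. 1 - q ^ (2 * k + 1)) * (\<Sum>k<2 * n. q ^ (k * (k + 1) div 2)) =
    (\<Sum>s<n. (\<Prod>k=s..<n. 1 - q ^ (2 * Suc k)) * (\<Prod>k<s. 1 - q ^ (2 * k + 1)) *
      q ^ (s * (2 * n + 1)))"
proof (induction n)
  case (Suc n)
  define D where "D s = (\<Prod>k<s. 1 - q ^ (2 * k + 1))" for s
  define g where "g m s = (\<Prod>k=s..<m. 1 - q ^ (2 * Suc k))" for m s
  define S where "S m = (\<Sum>k<2 * m. q ^ (k * (k + 1) div 2))" for m
  define t where "t m s = g m s * D s * q ^ (s * (2 * m + 1))" for m s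
  define B where "B s = (1 - q ^ (2 * s)) * g n s * D s * q ^ (s * (2 * n + 1))" for s
  define Q where "Q = q ^ (2 * n + 1)"
  have D_Suc: "D (Suc s) = D s * (1 - q ^ (2 * s + 1))" for s
    by (simp add: D_def)
  have g_Suc: "g (Suc n) s = g n s * (1 - Q * q)" if "s \<le> n" for s
    using that by (simp add: g_def Q_def algebra_simps)
  have g_step: "g n s = (1 - q ^ (2 * Suc s)) * g n (Suc s)" if "s < n" for s
    using that by (simp add: g_def prod.atLeast_Suc_lessThan)
  have g_self: "g m m = 1" for m by (simp add: g_def)
  have shift: "q ^ (s * (2 * Suc n + 1)) = q ^ (s * (2 * n + 1)) * q ^ (2 * s)" for s
    unfolding power_add[symmetric] by (simp add: algebra_simps)
  have step: "t (Suc n) s = (1 - Q) * t n s + (B (Suc s) - B s)" if "s < n" for s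
  proof -
    define u where "u = g n s * D s * q ^ (s * (2 * n + 1))"
    have "t (Suc n) s = u * (1 - Q * q) * q ^ (2 * s)"
      using that unfolding t_def u_def shift by (simp add: g_Suc mult_ac del: mult_Suc_right)
    moreover have "t n s = u" by (simp add: t_def u_def)
    moreover have "B s = (1 - q ^ (2 * s)) * u"
      by (simp add: B_def u_def algebra_simps)
    moreover have "q ^ (Suc s * (2 * n + 1)) = q ^ (s * (2 * n + 1)) * Q"
      unfolding Q_def power_add[symmetric] by (simp add: algebra_simps)
    then have "B (Suc s) = u * (1 - q ^ (2 * s) * q) * Q"
      using that by (simp add: B_def u_def D_Suc g_step[of s] algebra_simps)
    moreover have "Q = q ^ (2 * n) * q" by (simp add: Q_def)
    ultimately show ?thesis by (simp only:) (simp add: algebra_simps)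
  qed
  have sum: "(\<Sum>s<n. t (Suc n) s) = (1 - Q) * (\<Sum>s<n. t n s) + (B n - B 0)"
    by (simp add: step sum.distrib sum_distrib_left sum_lessThan_telescope)
  define R where "R = q ^ (n * (2 * n + 1))"
  have last: "t (Suc n) n = (1 - Q * q) * D n * R * q ^ (2 * n)"
    unfolding t_def shift R_def by (simp add: g_Suc g_self mult_ac del: mult_Suc_right)
  have Bn: "B n = (1 - q ^ (2 * n)) * D n * R"
    by (simp add: B_def g_self R_def)
  have B0: "B 0 = 0" by (simp add: B_def)
  have IH: "D n * S n = (\<Sum>s<n. t n s)"
    using Suc.IH by (simp add: D_def S_def g_def t_def)
  \<comment> \<open>Two summands are added at a time: the triangular numbers of index 2n and 2n + 1
    are n(2n + 1) and n(2n + 1) + (2n + 1).\<close>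
  have S_Suc: "S (Suc n) = S n + R + R * Q"
  proof -
    have "Suc (2 * n) * (Suc (2 * n) + 1) div 2 = n * (2 * n + 1) + (2 * n + 1)"
      by (simp add: algebra_simps)
    moreover have "2 * n * (2 * n + 1) div 2 = n * (2 * n + 1)"
      by simp
    moreover have "2 * Suc n = Suc (Suc (2 * n))" by simp
    ultimately show ?thesis
      unfolding S_def R_def Q_def power_add[symmetric] by (simp only: sum.lessThan_Suc)
  qed
  have Q: "Q = q ^ (2 * n) * q" by (simp add: Q_def)
  have "D (Suc n) * S (Suc n) = (1 - Q) * (D n * S n) + (1 - Q) * (1 + Q) * (D n * R)"
    unfolding S_Suc D_Suc Q_def[symmetric] by (simp add: algebra_simps)
  also have "\<dots> = (\<Sum>s<Suc n. t (Suc n) s)"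
    unfolding IH sum.lessThan_Suc sum last Bn B0 unfolding Q by (simp add: algebra_simps)
  finally show ?case
    by (simp only: D_def S_def g_def t_def)
qed simp

section \<open>Limits of formal power series\<close>

lemma tendsto_fps_mult:
  fixes F G :: "'b \<Rightarrow> 'a :: ring_1 fps"
  assumes "(F \<longlongrightarrow> A) U" "(G \<longlongrightarrow> B) U"
  shows "((\<lambda>x. F x * G x) \<longlongrightarrow> A * B) U"
proof (rule tendsto_fpsI)
  fix n
  have "\<forall>\<^sub>F x in U. \<forall>i\<in>{..n}. fps_nth (F x) i = fps_nth A i"
    using assms(1) by (intro eventually_ball_finite) (auto simp: tendsto_fps_iff)
  moreover have "\<forall>\<^sub>F x in U. \<forall>i\<in>{..n}. fps_nth (G x) i = fps_nth B i"
    using assms(2) by (intro eventually_ball_finite) (auto simp: tendsto_fps_iff)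
  ultimately show "\<forall>\<^sub>F x in U. fps_nth (F x * G x) n = fps_nth (A * B) n"
    by eventually_elim (simp add: fps_mult_nth)
qed

lemma tendsto_fps_add:
  fixes F G :: "'b \<Rightarrow> 'a :: ring_1 fps"
  assumes "(F \<longlongrightarrow> A) U" "(G \<longlongrightarrow> B) U"
  shows "((\<lambda>x. F x + G x) \<longlongrightarrow> A + B) U"
proof (rule tendsto_fpsI)
  fix n
  have "\<forall>\<^sub>F x in U. fps_nth (F x) n = fps_nth A n" "\<forall>\<^sub>F x in U. fps_nth (G x) n = fps_nth B n"
    using assms by (auto simp: tendsto_fps_iff)
  then show "\<forall>\<^sub>F x in U. fps_nth (F x + G x) n = fps_nth (A + B) n"
    by eventually_elim simp
qed

lemma tendsto_fps_compose:
  fixes F :: "'b \<Rightarrow> 'a :: ring_1 fps"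
  assumes "(F \<longlongrightarrow> A) U"
  shows "((\<lambda>x. F x oo g) \<longlongrightarrow> A oo g) U"
proof (rule tendsto_fpsI)
  fix n
  have "\<forall>\<^sub>F x in U. \<forall>i\<in>{..n}. fps_nth (F x) i = fps_nth A i"
    using assms by (intro eventually_ball_finite) (auto simp: tendsto_fps_iff)
  then show "\<forall>\<^sub>F x in U. fps_nth (F x oo g) n = fps_nth (A oo g) n"
    by eventually_elim (simp add: fps_compose_nth)
qed

lemma fps_nth_eq_if_X_power_dvd_diff:
  fixes F G :: "'a :: comm_ring_1 fps"
  assumes "fps_X ^ n dvd F - G" "i < n"
  shows "fps_nth F i = fps_nth G i"
proof -
  obtain H where "F - G = fps_X ^ n * H" using assms(1) by blast
  then have "fps_nth (F - G) i = 0"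
    using assms(2) by (simp add: fps_X_power_mult_nth)
  then show ?thesis by simp
qed

text \<open>An error divisible by X^n leaves the coefficients below n untouched. This discards the
  correction terms of the finite Gauss identities.\<close>

lemma fps_LIMSEQ_perturb:
  fixes F G :: "nat \<Rightarrow> 'a :: comm_ring_1 fps"
  assumes "G \<longlonglongrightarrow> A" "\<And>n. fps_X ^ n dvd F n - G n"
  shows "F \<longlonglongrightarrow> A"
proof (rule tendsto_fpsI)
  fix i
  have "\<forall>\<^sub>F n in sequentially. fps_nth (G n) i = fps_nth A i"
    using assms(1) by (simp add: tendsto_fps_iff)
  with eventually_gt_at_top[of i] show "\<forall>\<^sub>F n in sequentially. fps_nth (F n) i = fps_nth A i"
  proof eventually_elim
    case (elim n)
    then show ?case using fps_nth_eq_if_X_power_dvd_diff[OF assms(2)[of n], of i] by simp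
  qed
qed

lemma fps_convergentI:
  fixes F :: "nat \<Rightarrow> 'a :: comm_ring_1 fps"
  assumes "\<And>n. fps_X ^ n dvd F (Suc n) - F n"
  shows "convergent F"
proof (rule convergentI)
  \<comment> \<open>Coefficient i is frozen from index i + 1 on, so the limit can be read off along
    the diagonal.\<close>
  have stable: "fps_nth (F n) i = fps_nth (F (Suc i)) i" if "Suc i \<le> n" for i n
    using that
  proof (induction n rule: dec_induct)
    case (step n)
    then show ?case using fps_nth_eq_if_X_power_dvd_diff[OF assms, of i n] by simp
  qed simp
  show "F \<longlonglongrightarrow> Abs_fps (\<lambda>i. fps_nth (F (Suc i)) i)"
  proof (rule tendsto_fpsI)
    fix i
    show "\<forall>\<^sub>F n in sequentially. fps_nth (F n) i = fps_nth (Abs_fps (\<lambda>i. fps_nth (F (Suc i)) i)) i"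
      unfolding fps_nth_Abs_fps by (rule eventually_sequentiallyI[of "Suc i"]) (rule stable)
  qed
qed

section \<open>Theta series\<close>

text \<open>The q-Pochhammer symbol (q; q)_n. The argument is an arbitrary ring element so that
  \<open>fps_X ^ k\<close> and \<open>- fps_X\<close> can be inserted.\<close>

definition qprod :: "nat \<Rightarrow> 'a :: comm_ring_1 \<Rightarrow> 'a" where
  "qprod n q = (\<Prod>k<n. 1 - q ^ Suc k)"

text \<open>The sum of q^(m^2) over all integers m with |m| \<le> n, the terms for m and -m being
  collected.\<close>

definition sq_sum :: "nat \<Rightarrow> 'a :: comm_ring_1 \<Rightarrow> 'a" where
  "sq_sum n q = 1 + 2 * (\<Sum>k<n. q ^ (Suc k)\<^sup>2)"

definition tri_sum :: "nat \<Rightarrow> 'a :: comm_ring_1 \<Rightarrow> 'a" where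
  "tri_sum n q = (\<Sum>k<n. q ^ (k * (k + 1) div 2))"

lemma qprod_compose:
  fixes g :: "'a :: idom fps"
  assumes "fps_nth g 0 = 0"
  shows "qprod n a oo g = qprod n (a oo g)"
  unfolding qprod_def
  using assms by (simp add: fps_compose_prod_distrib fps_compose_sub_distrib fps_compose_power
      fps_compose_mult_distrib)

lemma numeral_compose [simp]: "numeral n oo g = (numeral n :: 'a :: comm_ring_1 fps)"
  by (simp add: fps_numeral_fps_const)

lemma sq_sum_X_compose:
  fixes g :: "'a :: idom fps"
  assumes "fps_nth g 0 = 0"
  shows "sq_sum n fps_X oo g = sq_sum n g"
  unfolding sq_sum_def
  using assms by (simp add: fps_compose_sum_distrib fps_compose_add_distrib fps_X_power_compose
      fps_compose_mult_distrib)

lemma tri_sum_X_compose: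
  fixes g :: "'a :: idom fps"
  assumes "fps_nth g 0 = 0"
  shows "tri_sum n fps_X oo g = tri_sum n g"
  unfolding tri_sum_def
  using assms by (simp add: fps_compose_sum_distrib fps_X_power_compose)

lemma euler_f_LIMSEQ:
  assumes "k > 0"
  shows "(\<lambda>n. qprod n (fps_X ^ k)) \<longlonglongrightarrow> euler_f k"
  unfolding qprod_def using has_prod_imp_tendsto'[OF euler_f_has_prod[OF assms]]
  by (simp only: power_mult[symmetric] Suc_eq_plus1)

lemma euler_f_nth_0 [simp]:
  assumes "k > 0"
  shows "fps_nth (euler_f k) 0 = 1"
proof -
  have "\<forall>\<^sub>F n in sequentially. fps_nth (qprod n (fps_X ^ k)) 0 = fps_nth (euler_f k) 0"
    using euler_f_LIMSEQ[OF assms] by (simp add: tendsto_fps_iff)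
  moreover have "fps_nth (qprod n (fps_X ^ k)) 0 = (1 :: rat)" for n
    unfolding qprod_def using assms by (induction n) (simp_all add: fps_power_zeroth)
  ultimately show ?thesis by simp
qed

lemma euler_f_nonzero [simp]: "k > 0 \<Longrightarrow> euler_f k \<noteq> 0"
  using euler_f_nth_0[of k] by (metis fps_zero_nth zero_neq_one)

lemma euler_f_compose:
  assumes "k > 0" "l > 0"
  shows "euler_f k oo fps_X ^ l = euler_f (k * l)"
proof (rule LIMSEQ_unique)
  show "(\<lambda>n. qprod n (fps_X ^ k) oo fps_X ^ l) \<longlonglongrightarrow> (euler_f k oo fps_X ^ l)"
    using euler_f_LIMSEQ[OF assms(1)] by (rule tendsto_fps_compose)
  have "fps_X ^ k oo fps_X ^ l = (fps_X ^ (k * l) :: rat fps)"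
    using assms by (simp add: fps_compose_power[symmetric] power_mult[symmetric] mult.commute)
  then show "(\<lambda>n. qprod n (fps_X ^ k) oo fps_X ^ l) \<longlonglongrightarrow> euler_f (k * l)"
    using euler_f_LIMSEQ[of "k * l"] assms by (simp add: qprod_compose)
qed

definition phi :: "rat fps" where "phi = lim (\<lambda>n. sq_sum n fps_X)"

definition psi :: "rat fps" where "psi = lim (\<lambda>n. tri_sum n fps_X)"

text \<open>Stated for a general substitution \<open>g\<close>, so that it serves for q, -q and q^4
  alike.\<close>

lemma phi_LIMSEQ:
  assumes "fps_nth g 0 = 0"
  shows "(\<lambda>n. sq_sum n g) \<longlonglongrightarrow> (phi oo g)"
proof -
  have "convergent (\<lambda>n. sq_sum n fps_X :: rat fps)"
  proof (rule fps_convergentI)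
    fix n
    have "(fps_X :: rat fps) ^ n dvd fps_X ^ (Suc n)\<^sup>2"
      by (rule le_imp_power_dvd) (simp add: power2_eq_square)
    then show "(fps_X :: rat fps) ^ n dvd sq_sum (Suc n) fps_X - sq_sum n fps_X"
      by (simp add: sq_sum_def algebra_simps del: power_Suc)
  qed
  then have "(\<lambda>n. sq_sum n fps_X oo g) \<longlonglongrightarrow> (phi oo g)"
    unfolding phi_def by (intro tendsto_fps_compose) (simp add: convergent_LIMSEQ_iff)
  then show ?thesis using assms by (simp add: sq_sum_X_compose)
qed

lemma psi_LIMSEQ:
  assumes "fps_nth g 0 = 0"
  shows "(\<lambda>n. tri_sum n g) \<longlonglongrightarrow> (psi oo g)"
proof -
  have "convergent (\<lambda>n. tri_sum n fps_X :: rat fps)"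
  proof (rule fps_convergentI)
    fix n :: nat
    have "n * 2 \<le> n * (n + 1)" by (cases n) auto
    from div_le_mono[OF this, of 2] have "n \<le> n * (n + 1) div 2" by simp
    then show "(fps_X :: rat fps) ^ n dvd tri_sum (Suc n) fps_X - tri_sum n fps_X"
      by (simp add: tri_sum_def le_imp_power_dvd)
  qed
  then have "(\<lambda>n. tri_sum n fps_X oo g) \<longlonglongrightarrow> (psi oo g)"
    unfolding psi_def by (intro tendsto_fps_compose) (simp add: convergent_LIMSEQ_iff)
  then show ?thesis using assms by (simp add: tri_sum_X_compose)
qed

section \<open>Product formulas and dissection of the theta series\<close>

lemma LIMSEQ_double:
  assumes "F \<longlonglongrightarrow> A"
  shows "(\<lambda>n. F (2 * n)) \<longlonglongrightarrow> A"
  using LIMSEQ_subseq_LIMSEQ[OF assms, of "\<lambda>n. 2 * n"]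
  by (simp add: strict_mono_def comp_def)

lemma qprod_double:
  "qprod (2 * n) q = (\<Prod>k<n. 1 - q ^ (2 * k + 1)) * qprod n (q\<^sup>2)"
proof (induction n)
  case (Suc n)
  have "q ^ (2 * n) * q * q = (q\<^sup>2) ^ Suc n" by (simp add: power_mult power2_eq_square)
  with Suc show ?case by (simp add: qprod_def algebra_simps)
qed (simp add: qprod_def)

lemma qprod_square: "qprod n (q\<^sup>2) = qprod n q * (\<Prod>k<n. 1 + q ^ Suc k)"
  unfolding qprod_def prod.distrib[symmetric]
  by (rule prod.cong)
    (simp_all add: power2_eq_square power_mult_distrib algebra_simps del: power_Suc)

text \<open>Split the factors by parity of the exponent. The sign change affects only the odd ones,
  and there (1 - q^m)(1 + q^m) = 1 - q^(2m).\<close>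

lemma qprod_neg:
  "qprod (2 * n) q * qprod (2 * n) (- q) * qprod n (q ^ 4) = qprod (2 * n) (q\<^sup>2) * (qprod n (q\<^sup>2))\<^sup>2"
proof -
  have neg: "qprod (2 * n) (- q) = (\<Prod>k<n. 1 + q ^ (2 * k + 1)) * qprod n (q\<^sup>2)"
    by (simp add: qprod_double)
  have sq: "qprod (2 * n) (q\<^sup>2) = (\<Prod>k<n. 1 - q ^ (2 * k + 1)) * (\<Prod>k<n. 1 + q ^ (2 * k + 1)) * qprod n (q ^ 4)"
  proof -
    have "(1 - q ^ (2 * k + 1)) * (1 + q ^ (2 * k + 1)) = 1 - (q\<^sup>2) ^ (2 * k + 1)" for k
      by (simp add: power_mult[symmetric] power_add[symmetric] mult_2 algebra_simps)
    then show ?thesis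
      unfolding qprod_double[of n "q\<^sup>2"] prod.distrib[symmetric] by (simp add: power_mult[symmetric])
  qed
  show ?thesis
    unfolding neg sq qprod_double[of n q] power2_eq_square[of "qprod n _"] by (simp only: mult_ac)
qed

text \<open>Allows f_1(-q) to be eliminated in favour of f_1, f_2 and f_4.\<close>

lemma euler_f_neg:
  "euler_f 1 * (euler_f 1 oo - fps_X) * euler_f 4 = euler_f 2 ^ 3"
proof (rule LIMSEQ_unique)
  let ?X = "fps_X :: rat fps"
  let ?L = "\<lambda>n. qprod (2 * n) ?X * qprod (2 * n) (- ?X) * qprod n (?X ^ 4)"
  have e1: "(\<lambda>n. qprod n ?X) \<longlonglongrightarrow> euler_f 1"
    using euler_f_LIMSEQ[of 1] by simp
  have "(\<lambda>n. qprod n (- ?X)) \<longlonglongrightarrow> (euler_f 1 oo - fps_X)"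
    using tendsto_fps_compose[OF e1, of "- fps_X"] by (simp add: qprod_compose)
  then show "?L \<longlonglongrightarrow> euler_f 1 * (euler_f 1 oo - fps_X) * euler_f 4"
    by (intro tendsto_fps_mult LIMSEQ_double[OF e1] LIMSEQ_double[of "\<lambda>n. qprod n (- ?X)"]
        euler_f_LIMSEQ zero_less_numeral)
  have e2: "(\<lambda>n. qprod n (?X\<^sup>2)) \<longlonglongrightarrow> euler_f 2"
    using euler_f_LIMSEQ[of 2] by simp
  have "(\<lambda>n. qprod (2 * n) (?X\<^sup>2) * (qprod n (?X\<^sup>2) * qprod n (?X\<^sup>2))) \<longlonglongrightarrow>
      euler_f 2 * (euler_f 2 * euler_f 2)"
    by (intro tendsto_fps_mult LIMSEQ_double[OF e2] e2)
  then show "?L \<longlonglongrightarrow> euler_f 2 ^ 3"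
    unfolding qprod_neg by (simp add: power2_eq_square power3_eq_cube mult.assoc)
qed

lemma phi_neg_eq: "euler_f 2 * (phi oo - fps_X) = (euler_f 1)\<^sup>2"
proof (rule LIMSEQ_unique)
  let ?X = "fps_X :: rat fps"
  let ?L = "\<lambda>n. qprod n (?X\<^sup>2) * sq_sum n (- ?X)"
  define r where "r n = (\<Sum>s<n. (-1) ^ Suc s * (\<Prod>k=Suc s..<n. 1 - ?X ^ Suc k) *
      (\<Prod>k<s. 1 + ?X ^ Suc k) * ?X ^ (Suc s * Suc n))" for n
  show "?L \<longlonglongrightarrow> euler_f 2 * (phi oo - fps_X)"
    by (intro tendsto_fps_mult euler_f_LIMSEQ phi_LIMSEQ) auto
  have "sq_sum n (- q) = 1 + 2 * (\<Sum>k<n. (-1) ^ Suc k * q ^ (Suc k)\<^sup>2)" for n and q :: "rat fps"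
  proof -
    \<comment> \<open>A square has the parity of its root, so q -> -q produces the alternating signs
      of the finite identity.\<close>
    have "(- q) ^ (Suc k)\<^sup>2 = (-1) ^ Suc k * q ^ (Suc k)\<^sup>2" for k
      unfolding power_minus[of q] by (simp add: minus_one_power_iff del: power_Suc)
    then show ?thesis by (simp add: sq_sum_def del: power_Suc)
  qed
  then have L: "?L n = qprod n ?X * (qprod n ?X + 2 * r n)" for n
    unfolding qprod_square mult.assoc
    by (simp only: gauss_square_finite r_def qprod_def)
  have e1: "(\<lambda>n. qprod n ?X) \<longlonglongrightarrow> euler_f 1"
    using euler_f_LIMSEQ[of 1] by simp
  have "?X ^ n dvd r n" for n
    unfolding r_def by (intro dvd_sum dvd_mult le_imp_power_dvd) simp
  then have "(\<lambda>n. qprod n ?X + 2 * r n) \<longlonglongrightarrow> euler_f 1"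
    by (intro fps_LIMSEQ_perturb[OF e1]) simp
  from tendsto_fps_mult[OF e1 this] show "?L \<longlonglongrightarrow> (euler_f 1)\<^sup>2"
    unfolding L power2_eq_square[of "euler_f 1"] .
qed

lemma psi_eq: "euler_f 1 * psi = (euler_f 2)\<^sup>2"
proof (rule LIMSEQ_unique)
  let ?X = "fps_X :: rat fps"
  let ?L = "\<lambda>n. qprod (2 * n) ?X * tri_sum (2 * n) ?X"
  define r where "r n = (\<Sum>s<n. (\<Prod>k=s..<n. 1 - ?X ^ (2 * Suc k)) * (\<Prod>k<s. 1 - ?X ^ (2 * k + 1)) *
      ?X ^ (s * (2 * n + 1)))" for n
  have e1: "(\<lambda>n. qprod n ?X) \<longlonglongrightarrow> euler_f 1"
    using euler_f_LIMSEQ[of 1] by simp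
  have e2: "(\<lambda>n. qprod n (?X\<^sup>2)) \<longlonglongrightarrow> euler_f 2"
    using euler_f_LIMSEQ[of 2] by simp
  have "(\<lambda>n. tri_sum n ?X) \<longlonglongrightarrow> psi"
    using psi_LIMSEQ[of fps_X] by simp
  then show "?L \<longlonglongrightarrow> euler_f 1 * psi"
    by (intro tendsto_fps_mult LIMSEQ_double[OF e1] LIMSEQ_double[of "\<lambda>n. tri_sum n ?X"])
  \<comment> \<open>Splitting \<open>qprod (2 * n)\<close> by parity isolates the odd-exponent
    product that the finite identity needs.\<close>
  have L: "?L n = qprod n (?X\<^sup>2) * r n" for n
    unfolding qprod_double tri_sum_def r_def gauss_triangular_finite[of ?X n, symmetric]
    by (simp only: mult_ac)
  have "?X ^ n dvd r n - qprod n (?X\<^sup>2)" for n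
  proof (cases n)
    case (Suc m)
    define t where "t s = (\<Prod>k=s..<n. 1 - ?X ^ (2 * Suc k)) * (\<Prod>k<s. 1 - ?X ^ (2 * k + 1)) *
      ?X ^ (s * (2 * n + 1))" for s
    \<comment> \<open>The main term is s = 0; the exponent s(2n + 1) makes all others divisible by
      X^n.\<close>
    have "r n = t 0 + (\<Sum>s<m. t (Suc s))"
      unfolding r_def t_def Suc sum.lessThan_Suc_shift ..
    moreover have "t 0 = qprod n (?X\<^sup>2)"
      by (simp add: t_def qprod_def power_mult[symmetric] atLeast0LessThan power_add[symmetric] mult_2)
    moreover have "?X ^ n dvd (\<Sum>s<m. t (Suc s))"
      unfolding t_def by (intro dvd_sum dvd_mult le_imp_power_dvd) simp
    ultimately show ?thesis by simp
  qed simp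
  from tendsto_fps_mult[OF e2 fps_LIMSEQ_perturb[OF e2 this]]
  show "?L \<longlonglongrightarrow> (euler_f 2)\<^sup>2"
    unfolding L power2_eq_square[of "euler_f 2"] .
qed

text \<open>Even squares are (2m)^2 = 4m^2, and odd squares are (2m + 1)^2 = 8T + 1 with T = m(m +
  1)/2.\<close>

lemma sq_sum_double: "sq_sum (2 * n) q = sq_sum n (q ^ 4) + 2 * q * tri_sum n (q ^ 8)"
proof (induction n)
  case (Suc n)
  have "even (n * (n + 1))" by simp
  then have "8 * (n * (n + 1) div 2) = 4 * (n * (n + 1))" by presburger
  then have "Suc (8 * (n * (n + 1) div 2)) = (Suc (2 * n))\<^sup>2"
    by (simp add: power2_eq_square algebra_simps)
  then have "q * (q ^ 8) ^ (n * (n + 1) div 2) = q ^ (Suc (2 * n))\<^sup>2"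
    by (simp only: power_mult[symmetric] power_Suc[symmetric])
  moreover have "4 * (Suc n)\<^sup>2 = (Suc (Suc (2 * n)))\<^sup>2"
    by (simp add: power2_eq_square algebra_simps)
  then have "(q ^ 4) ^ (Suc n)\<^sup>2 = q ^ (Suc (Suc (2 * n)))\<^sup>2"
    by (simp only: power_mult[symmetric])
  moreover have "sq_sum (2 * Suc n) q = sq_sum (2 * n) q + 2 * q ^ (Suc (2 * n))\<^sup>2 + 2 * q ^ (Suc (Suc (2 * n)))\<^sup>2"
    by (simp add: sq_sum_def algebra_simps)
  moreover have "sq_sum (Suc n) (q ^ 4) = sq_sum n (q ^ 4) + 2 * (q ^ 4) ^ (Suc n)\<^sup>2"
    by (simp add: sq_sum_def algebra_simps)
  moreover have "tri_sum (Suc n) (q ^ 8) = tri_sum n (q ^ 8) + (q ^ 8) ^ (n * (n + 1) div 2)"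
    by (simp add: tri_sum_def)
  ultimately show ?case using Suc by (simp only: distrib_left mult.assoc add_ac)
qed (simp add: sq_sum_def tri_sum_def)

lemma phi_dissection: "phi = (phi oo fps_X ^ 4) + 2 * fps_X * (psi oo fps_X ^ 8)"
proof (rule LIMSEQ_unique)
  have "(\<lambda>n. sq_sum n fps_X) \<longlonglongrightarrow> phi"
    using phi_LIMSEQ[of fps_X] by simp
  then show "(\<lambda>n. sq_sum (2 * n) fps_X) \<longlonglongrightarrow> phi"
    by (rule LIMSEQ_double)
  show "(\<lambda>n. sq_sum (2 * n) fps_X) \<longlonglongrightarrow> (phi oo fps_X ^ 4) + 2 * fps_X * (psi oo fps_X ^ 8)"
    unfolding sq_sum_double
    by (intro tendsto_fps_add tendsto_fps_mult phi_LIMSEQ psi_LIMSEQ tendsto_const) auto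
qed

section \<open>Substitutions in power series and Jacobi's identity\<close>

lemma fps_compose_X_power_X_power:
  assumes "k > 0" "l > 0"
  shows "(F oo fps_X ^ k) oo fps_X ^ l = (F oo fps_X ^ (k * l) :: 'a :: idom fps)"
  using assms by (subst fps_compose_assoc[symmetric])
    (simp_all add: fps_X_power_compose power_mult[symmetric] mult.commute)

lemma fps_compose_X_power_uminus:
  assumes "even k" "k > 0"
  shows "(F oo fps_X ^ k) oo - fps_X = (F oo fps_X ^ k :: 'a :: idom fps)"
  using assms by (subst fps_compose_assoc[symmetric]) (simp_all add: fps_X_power_compose)

lemma fps_compose_uminus_uminus: "(F oo - fps_X) oo - fps_X = (F :: 'a :: idom fps)"
  by (subst fps_compose_assoc[symmetric]) (simp_all add: fps_compose_uminus)

lemmas fps_compose_ring = fps_compose_add_distrib fps_compose_sub_distrib fps_compose_uminus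
  fps_compose_mult_distrib fps_compose_power[symmetric]

text \<open>Gauss's formula for \<open>phi\<close> at -q is taken at -q once more, and the resulting
  f_1(-q) is removed by \<open>euler_f_neg\<close>.\<close>

lemma phi_eq: "phi * (euler_f 1)\<^sup>2 * (euler_f 4)\<^sup>2 = euler_f 2 ^ 5"
proof -
  define e where "e = euler_f 1 oo - fps_X"
  have "euler_f 2 oo - fps_X = euler_f 2"
    using euler_f_compose[of 1 2] fps_compose_X_power_uminus[of 2 "euler_f 1"] by simp
  then have "euler_f 2 * phi = e\<^sup>2"
    using arg_cong[OF phi_neg_eq, of "\<lambda>F. F oo - fps_X"]
    by (simp add: fps_compose_ring fps_compose_uminus_uminus e_def)
  then have "euler_f 2 * (phi * (euler_f 1)\<^sup>2 * (euler_f 4)\<^sup>2) = (euler_f 1 * e * euler_f 4)\<^sup>2"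
    by (simp add: power_mult_distrib mult_ac)
  also have "\<dots> = (euler_f 2 ^ 3)\<^sup>2" unfolding e_def euler_f_neg ..
  also have "\<dots> = euler_f 2 * euler_f 2 ^ 5" by (simp add: power_mult[symmetric] power_Suc[symmetric] del: power_Suc)
  finally show ?thesis by simp
qed

text \<open>The identity \<open>\<phi>(q) \<phi>(-q) = \<phi>(-q\<^sup>2)\<^sup>2\<close>, read off from the products, is a relation between
  series in \<open>q\<^sup>2\<close>; replacing \<open>q\<^sup>2\<close> by \<open>-q\<close> gives the claim.\<close>

lemma phi_square: "phi\<^sup>2 = (phi oo fps_X\<^sup>2)\<^sup>2 + 4 * fps_X * (psi oo fps_X ^ 4)\<^sup>2"
proof -
  define p where "p = phi oo - fps_X"
  define a where "a = phi oo fps_X\<^sup>2"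
  define b where "b = psi oo fps_X ^ 4"
  have a2: "a oo fps_X\<^sup>2 = phi oo fps_X ^ 4" and b2: "b oo fps_X\<^sup>2 = psi oo fps_X ^ 8"
    by (simp_all add: a_def b_def fps_compose_X_power_X_power)
  have phi: "phi = (a oo fps_X\<^sup>2) + 2 * fps_X * (b oo fps_X\<^sup>2)"
    unfolding a2 b2 by (rule phi_dissection)
  have p: "p = (a oo fps_X\<^sup>2) - 2 * fps_X * (b oo fps_X\<^sup>2)"
    using arg_cong[OF phi, of "\<lambda>F. F oo - fps_X"]
    by (simp add: fps_compose_ring fps_compose_X_power_uminus p_def)
  have p2: "euler_f 4 * (p oo fps_X\<^sup>2) = (euler_f 2)\<^sup>2"
    using arg_cong[OF phi_neg_eq, of "\<lambda>F. F oo fps_X\<^sup>2"]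
    by (simp add: fps_compose_ring p_def euler_f_compose)
  \<comment> \<open>This factor clears the denominators in the product formulas for
    \<open>phi\<close>, \<open>p\<close> and \<open>p oo fps_X\<^sup>2\<close>.\<close>
  let ?K = "(euler_f 1)\<^sup>2 * (euler_f 4)\<^sup>2 * euler_f 2"
  have "phi * p * ?K = (phi * (euler_f 1)\<^sup>2 * (euler_f 4)\<^sup>2) * (euler_f 2 * p)"
    by (simp only: mult_ac)
  also have "\<dots> = euler_f 2 ^ 5 * (euler_f 1)\<^sup>2"
    unfolding phi_eq p_def phi_neg_eq ..
  also have "\<dots> = ((euler_f 2)\<^sup>2)\<^sup>2 * (euler_f 1)\<^sup>2 * euler_f 2"
    by (simp add: power_mult[symmetric] power_numeral_reduce)
  also have "\<dots> = (p oo fps_X\<^sup>2)\<^sup>2 * ?K"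
    unfolding p2[symmetric] by (simp only: mult_ac power_mult_distrib)
  finally have "phi * p = (p oo fps_X\<^sup>2)\<^sup>2"
    by simp
  moreover have "phi * p = (a oo fps_X\<^sup>2)\<^sup>2 - 4 * fps_X\<^sup>2 * (b oo fps_X\<^sup>2)\<^sup>2"
    unfolding p by (subst phi) (simp add: power2_eq_square algebra_simps)
  ultimately have "(p\<^sup>2 - (a\<^sup>2 - 4 * fps_X * b\<^sup>2)) oo fps_X\<^sup>2 = 0"
    by (simp add: fps_compose_ring)
  then have "p\<^sup>2 - (a\<^sup>2 - 4 * fps_X * b\<^sup>2) = 0"
    by (subst (asm) fps_compose_eq_0_iff) auto
  then have "p\<^sup>2 = a\<^sup>2 - 4 * fps_X * b\<^sup>2" by simp
  from arg_cong[OF this, of "\<lambda>F. F oo - fps_X"] show ?thesis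
    by (simp add: fps_compose_ring p_def fps_compose_uminus_uminus a_def b_def
        fps_compose_X_power_uminus)
qed

text \<open>The product form of \<phi>(q)^4 - \<phi>(-q)^4 = 16 q \<psi>(q^2)^4. By
  \<open>phi_square\<close> the squares of \<phi>(q) and \<phi>(-q) are a^2 + 4qb^2 and a^2 - 4qb^2,
  so the difference of their squares is 16 q (ab)^2.\<close>

lemma jacobi_aequatio:
  "euler_f 2 ^ 24 = euler_f 1 ^ 16 * euler_f 4 ^ 8 + 16 * fps_X * euler_f 1 ^ 8 * euler_f 4 ^ 16"
proof -
  define p where "p = phi oo - fps_X"
  define a where "a = phi oo fps_X\<^sup>2"
  define b where "b = psi oo fps_X ^ 4"
  have phi2: "phi\<^sup>2 = a\<^sup>2 + 4 * fps_X * b\<^sup>2"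
    unfolding a_def b_def by (rule phi_square)
  have p2: "p\<^sup>2 = a\<^sup>2 - 4 * fps_X * b\<^sup>2"
    using arg_cong[OF phi2, of "\<lambda>F. F oo - fps_X"]
    by (simp add: fps_compose_ring p_def a_def b_def fps_compose_X_power_uminus)
  have diff: "(phi\<^sup>2)\<^sup>2 - (p\<^sup>2)\<^sup>2 = 16 * fps_X * (a * b)\<^sup>2"
    unfolding phi2 p2 by (simp add: power2_eq_square algebra_simps)
  have a: "a * (euler_f 2)\<^sup>2 * (euler_f 8)\<^sup>2 = euler_f 4 ^ 5"
    using arg_cong[OF phi_eq, of "\<lambda>F. F oo fps_X\<^sup>2"]
    by (simp add: fps_compose_ring a_def euler_f_compose)
  have b: "euler_f 4 * b = (euler_f 8)\<^sup>2"
    using arg_cong[OF psi_eq, of "\<lambda>F. F oo fps_X ^ 4"]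
    by (simp add: fps_compose_ring b_def euler_f_compose)
  \<comment> \<open>The factors f_8 cancel: ab = f_4^4 / f_2^2, which is \<psi>(q^2)^2.\<close>
  have "(a * b * (euler_f 2)\<^sup>2) * ((euler_f 8)\<^sup>2 * euler_f 4) =
      (a * (euler_f 2)\<^sup>2 * (euler_f 8)\<^sup>2) * (euler_f 4 * b)"
    by (simp only: mult_ac)
  also have "\<dots> = euler_f 4 ^ 4 * ((euler_f 8)\<^sup>2 * euler_f 4)"
    unfolding a b by (simp add: power_numeral_reduce)
  finally have ab: "a * b * (euler_f 2)\<^sup>2 = euler_f 4 ^ 4" by simp
  let ?K = "euler_f 1 ^ 8 * euler_f 4 ^ 8 * euler_f 2 ^ 4"
  have "(phi\<^sup>2)\<^sup>2 * ?K = (phi * (euler_f 1)\<^sup>2 * (euler_f 4)\<^sup>2) ^ 4 * euler_f 2 ^ 4"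
    by (simp add: power_mult_distrib power_mult[symmetric])
  also have "\<dots> = euler_f 2 ^ 24"
    unfolding phi_eq by (simp add: power_mult[symmetric] power_add[symmetric])
  finally have K1: "(phi\<^sup>2)\<^sup>2 * ?K = euler_f 2 ^ 24" .
  have "(p\<^sup>2)\<^sup>2 * ?K = (euler_f 2 * p) ^ 4 * euler_f 1 ^ 8 * euler_f 4 ^ 8"
    by (simp add: power_mult_distrib power_mult[symmetric] mult_ac)
  also have "\<dots> = euler_f 1 ^ 16 * euler_f 4 ^ 8"
    unfolding p_def phi_neg_eq by (simp add: power_mult[symmetric] power_add[symmetric])
  finally have K2: "(p\<^sup>2)\<^sup>2 * ?K = euler_f 1 ^ 16 * euler_f 4 ^ 8" .
  have "(a * b)\<^sup>2 * ?K = (a * b * (euler_f 2)\<^sup>2)\<^sup>2 * euler_f 1 ^ 8 * euler_f 4 ^ 8"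
    by (simp add: power_mult_distrib power_mult[symmetric] mult_ac)
  also have "\<dots> = euler_f 1 ^ 8 * (euler_f 4 ^ 8 * euler_f 4 ^ 8)"
    unfolding ab by (simp add: power_mult[symmetric])
  also have "\<dots> = euler_f 1 ^ 8 * euler_f 4 ^ 16"
    unfolding power_add[symmetric] by simp
  finally have K3: "(a * b)\<^sup>2 * ?K = euler_f 1 ^ 8 * euler_f 4 ^ 16" .
  have "euler_f 2 ^ 24 - euler_f 1 ^ 16 * euler_f 4 ^ 8 = ((phi\<^sup>2)\<^sup>2 - (p\<^sup>2)\<^sup>2) * ?K"
    by (simp only: left_diff_distrib K1 K2)
  also have "\<dots> = 16 * fps_X * ((a * b)\<^sup>2 * ?K)"
    by (simp only: diff mult_ac)
  finally show ?thesis unfolding K3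
    by (simp add: diff_eq_eq add.commute mult.assoc)
qed

section \<open>The even part operator and the matrix recursion\<close>

definition even_part :: "'a :: zero fps \<Rightarrow> 'a fps" where
  "even_part F = Abs_fps (\<lambda>n. fps_nth F (2 * n))"

lemma even_part_nth [simp]: "fps_nth (even_part F) n = fps_nth F (2 * n)"
  by (simp add: even_part_def)

lemma even_part_add: "even_part (F + G) = even_part F + even_part (G :: 'a :: monoid_add fps)"
  by (simp add: fps_eq_iff)

lemma even_part_sum: "even_part (\<Sum>i\<in>A. F i) = (\<Sum>i\<in>A. even_part (F i :: 'a :: comm_monoid_add fps))"
  by (simp add: fps_eq_iff fps_sum_nth)

lemma even_part_of_int_mult:
  "even_part (of_int z * F) = of_int z * even_part (F :: 'a :: comm_ring_1 fps)"
  by (simp add: fps_eq_iff fps_of_int[symmetric])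

lemma even_part_one: "even_part 1 = (1 :: 'a :: zero_neq_one fps)"
  by (simp add: fps_eq_iff)

lemma fps_nth_compose_X2:
  "fps_nth (G oo fps_X\<^sup>2) n = (if even n then fps_nth G (n div 2) else (0 :: 'a :: comm_ring_1))"
proof -
  have "fps_nth (G oo fps_X\<^sup>2) n = (\<Sum>i = 0..n. if n = 2 * i then fps_nth G i else 0)"
    unfolding fps_compose_nth power_mult[symmetric] by (intro sum.cong) auto
  also have "\<dots> = (\<Sum>i \<in> {0..n}. if i = n div 2 then (if even n then fps_nth G i else 0) else 0)"
    by (intro sum.cong) auto
  also have "\<dots> = (if even n then fps_nth G (n div 2) else 0)"
    by (subst sum.delta) auto
  finally show ?thesis .
qed

text \<open>Series in q^2 behave as scalars for \<open>U\<close>: their odd coefficients vanish, so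
  only even indices contribute to the convolution.\<close>

lemma even_part_compose_mult:
  fixes F G :: "'a :: comm_ring_1 fps"
  shows "even_part ((G oo fps_X\<^sup>2) * F) = G * even_part F"
proof (rule fps_ext)
  fix n
  have "fps_nth (even_part ((G oo fps_X\<^sup>2) * F)) n =
      (\<Sum>i = 0..2 * n. fps_nth (G oo fps_X\<^sup>2) i * fps_nth F (2 * n - i))"
    by (simp add: fps_mult_nth)
  also have "\<dots> = (\<Sum>i \<in> (*) 2 ` {0..n}. fps_nth (G oo fps_X\<^sup>2) i * fps_nth F (2 * n - i))"
    by (rule sum.mono_neutral_right) (auto simp: fps_nth_compose_X2 elim!: evenE)
  also have "\<dots> = (\<Sum>i = 0..n. fps_nth G i * fps_nth (even_part F) (n - i))"
    by (subst sum.reindex) (auto simp: inj_on_def fps_nth_compose_X2 right_diff_distrib')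
  finally show "fps_nth (even_part ((G oo fps_X\<^sup>2) * F)) n = fps_nth (G * even_part F) n"
    by (simp add: fps_mult_nth)
qed

lemma even_part_add_uminus:
  fixes F :: "'a :: idom fps"
  shows "even_part (F + (F oo - fps_X)) = 2 * even_part F"
  by (simp add: fps_eq_iff fps_compose_uminus' numeral_fps_const)

text \<open>The shift by q decides which half is kept: one factor q selects the odd-indexed terms,
  and in the next lemma two factors select the even-indexed ones. Either way one factor q
  remains.\<close>

lemma even_part_X_mult: "even_part (fps_X * Abs_fps f) = fps_X * Abs_fps (\<lambda>n. f (2 * n + 1) :: 'a :: comm_ring_1)"
proof (rule fps_ext)
  fix n
  show "fps_nth (even_part (fps_X * Abs_fps f)) n = fps_nth (fps_X * Abs_fps (\<lambda>n. f (2 * n + 1))) n"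
    by (cases n) simp_all
qed

lemma even_part_X2_mult: "even_part (fps_X * (fps_X * Abs_fps f)) = fps_X * Abs_fps (\<lambda>n. f (2 * n) :: 'a :: comm_ring_1)"
proof (rule fps_ext)
  fix n
  show "fps_nth (even_part (fps_X * (fps_X * Abs_fps f))) n = fps_nth (fps_X * Abs_fps (\<lambda>n. f (2 * n))) n"
    by (cases n) simp_all
qed

section \<open>Relations between \<open>xi\<close> and \<open>zeta\<close>\<close>

definition xi :: "rat fps" where
  "xi = fps_X * (euler_f 2 ^ 24 / euler_f 1 ^ 24)"

definition zeta :: "rat fps" where
  "zeta = fps_X * (euler_f 4 ^ 8 / euler_f 1 ^ 8)"

lemma fps_divide_mult_cancel:
  fixes F G :: "'a :: field fps"
  assumes "fps_nth G 0 \<noteq> 0"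
  shows "F / G * G = F"
  using assms by (simp add: fps_divide_unit mult.assoc inverse_mult_eq_1)

lemma euler_f_power_nth_0: "k > 0 \<Longrightarrow> fps_nth (euler_f k ^ n) 0 \<noteq> 0"
  by (simp add: fps_power_zeroth)

lemma xi_eq: "xi * euler_f 1 ^ 24 = fps_X * euler_f 2 ^ 24"
  unfolding xi_def mult.assoc by (subst fps_divide_mult_cancel) (simp_all add: fps_power_zeroth)

lemma zeta_eq: "zeta * euler_f 1 ^ 8 = fps_X * euler_f 4 ^ 8"
  unfolding zeta_def mult.assoc by (subst fps_divide_mult_cancel) (simp_all add: fps_power_zeroth)

lemma xi_nonzero: "xi \<noteq> 0"
  using xi_eq by auto

lemma xi_power: "xi ^ j = fps_X ^ j * (euler_f 2 ^ (24 * j) / euler_f 1 ^ (24 * j))"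
proof -
  have "xi ^ j * euler_f 1 ^ (24 * j) = fps_X ^ j * euler_f 2 ^ (24 * j)"
    unfolding power_mult power_mult_distrib[symmetric] xi_eq ..
  also have "\<dots> = fps_X ^ j * (euler_f 2 ^ (24 * j) / euler_f 1 ^ (24 * j)) * euler_f 1 ^ (24 * j)"
    unfolding mult.assoc by (subst fps_divide_mult_cancel) (simp_all add: fps_power_zeroth)
  finally show ?thesis by simp
qed

lemma xi2_eq: "(xi oo fps_X\<^sup>2) * euler_f 2 ^ 24 = fps_X\<^sup>2 * euler_f 4 ^ 24"
  using arg_cong[OF xi_eq, of "\<lambda>F. F oo fps_X\<^sup>2"]
  by (simp add: fps_compose_ring euler_f_compose)

text \<open>The factors f_2^24 cancel, leaving q^3 f_4^24 / f_1^24.\<close>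

lemma xi_mult_xi2: "(xi oo fps_X\<^sup>2) * xi = zeta ^ 3"
proof -
  have "(xi oo fps_X\<^sup>2) * xi * (euler_f 2 ^ 24 * euler_f 1 ^ 24) =
      ((xi oo fps_X\<^sup>2) * euler_f 2 ^ 24) * (xi * euler_f 1 ^ 24)"
    by (simp only: mult_ac)
  also have "\<dots> = (fps_X * euler_f 4 ^ 8) ^ 3 * euler_f 2 ^ 24"
    unfolding xi2_eq xi_eq
    by (simp add: power_mult_distrib power_mult[symmetric] power2_eq_square power3_eq_cube mult_ac)
  also have "\<dots> = zeta ^ 3 * (euler_f 2 ^ 24 * euler_f 1 ^ 24)"
    unfolding zeta_eq[symmetric] by (simp add: power_mult_distrib power_mult[symmetric] mult_ac)
  finally show ?thesis by simp
qed

text \<open>Jacobi's identity multiplied by q^2 f_4^16 and divided by f_1^16 f_2^24.\<close>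

lemma zeta_square: "zeta\<^sup>2 = (xi oo fps_X\<^sup>2) * (16 * zeta + 1)"
proof -
  let ?K = "euler_f 1 ^ 16 * euler_f 2 ^ 24"
  have "zeta\<^sup>2 * ?K = (zeta * euler_f 1 ^ 8)\<^sup>2 * euler_f 2 ^ 24"
    by (simp add: power_mult_distrib power_mult[symmetric] mult_ac)
  also have "\<dots> = fps_X\<^sup>2 * euler_f 4 ^ 16 *
      (euler_f 1 ^ 16 * euler_f 4 ^ 8 + 16 * fps_X * euler_f 1 ^ 8 * euler_f 4 ^ 16)"
    unfolding zeta_eq jacobi_aequatio by (simp add: power_mult_distrib power_mult[symmetric])
  also have "\<dots> = fps_X\<^sup>2 * (euler_f 4 ^ 16 * euler_f 4 ^ 8) *
      (euler_f 1 ^ 16 + 16 * euler_f 1 ^ 8 * (fps_X * euler_f 4 ^ 8))"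
  proof -
    have "euler_f 4 ^ 16 = euler_f 4 ^ 8 * euler_f 4 ^ 8"
      unfolding power_add[symmetric] by simp
    then show ?thesis by (simp only: distrib_left mult_ac)
  qed
  also have "\<dots> = (fps_X\<^sup>2 * euler_f 4 ^ 24) * (euler_f 1 ^ 16 + 16 * zeta * (euler_f 1 ^ 8 * euler_f 1 ^ 8))"
    unfolding zeta_eq[symmetric] power_add[symmetric, of "euler_f 4"] by (simp add: mult_ac)
  also have "\<dots> = (xi oo fps_X\<^sup>2) * (16 * zeta + 1) * ?K"
    unfolding xi2_eq[symmetric] power_add[symmetric] by (simp add: algebra_simps)
  finally show ?thesis by simp
qed

text \<open>By \<open>euler_f_neg\<close>, \<zeta>(-q) = -q f_1^8 f_4^16 / f_2^24; adding \<zeta>(q)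
  gives Jacobi's identity again. This determines \<open>U\<close> on \<open>zeta\<close> and so
  starts the recurrence.\<close>

lemma zeta_trace: "zeta + (zeta oo - fps_X) = 16 * (xi oo fps_X\<^sup>2)"
proof -
  define e where "e = euler_f 1 oo - fps_X"
  have "euler_f 4 oo - fps_X = euler_f 4"
    using euler_f_compose[of 1 4] fps_compose_X_power_uminus[of 4 "euler_f 1"] by simp
  then have c': "(zeta oo - fps_X) * e ^ 8 = - fps_X * euler_f 4 ^ 8"
    using arg_cong[OF zeta_eq, of "\<lambda>F. F oo - fps_X"]
    by (simp add: fps_compose_ring e_def)
  have e: "euler_f 1 ^ 8 * e ^ 8 * euler_f 4 ^ 8 = euler_f 2 ^ 24"
    using arg_cong[OF euler_f_neg, of "\<lambda>F. F ^ 8"]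
    unfolding e_def[symmetric] power_mult_distrib power_mult[symmetric] by simp
  then have "e \<noteq> 0" by auto
  have e16: "euler_f 1 ^ 8 * euler_f 1 ^ 8 = euler_f 1 ^ 16"
    unfolding power_add[symmetric] by simp
  have e24: "euler_f 4 ^ 8 * euler_f 4 ^ 16 = euler_f 4 ^ 24"
    unfolding power_add[symmetric] by simp
  let ?K = "(euler_f 1 ^ 8 * e ^ 8 * euler_f 4 ^ 8) * euler_f 1 ^ 8"
  have "(zeta + (zeta oo - fps_X)) * ?K =
     (zeta * euler_f 1 ^ 8) * (euler_f 1 ^ 8 * e ^ 8 * euler_f 4 ^ 8) +
     ((zeta oo - fps_X) * e ^ 8) * ((euler_f 1 ^ 8 * euler_f 1 ^ 8) * euler_f 4 ^ 8)"
    by (simp only: distrib_right mult_ac)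
  also have "\<dots> = fps_X * euler_f 4 ^ 8 * (euler_f 2 ^ 24 - euler_f 1 ^ 16 * euler_f 4 ^ 8)"
    unfolding zeta_eq c' e e16 by (simp add: right_diff_distrib)
  also have "\<dots> = fps_X * euler_f 4 ^ 8 * (16 * fps_X * euler_f 1 ^ 8 * euler_f 4 ^ 16)"
    unfolding jacobi_aequatio by simp
  also have "\<dots> = 16 * (fps_X\<^sup>2 * (euler_f 4 ^ 8 * euler_f 4 ^ 16)) * euler_f 1 ^ 8"
    by (simp add: power2_eq_square mult_ac)
  also have "\<dots> = 16 * (xi oo fps_X\<^sup>2) * ?K"
    unfolding e24 e xi2_eq[symmetric] by (simp add: mult_ac)
  finally show ?thesis using \<open>e \<noteq> 0\<close> by simp
qed

lemma even_part_zeta: "even_part zeta = 8 * xi"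
proof -
  have "2 * even_part zeta = even_part ((xi oo fps_X\<^sup>2) * 16)"
    unfolding even_part_add_uminus[symmetric] zeta_trace by (simp add: mult.commute)
  also have "\<dots> = xi * 16 * even_part 1"
    unfolding even_part_compose_mult using even_part_of_int_mult[of 16 "1 :: rat fps"] by simp
  finally have "2 * even_part zeta = 2 * (8 * xi)" by (simp add: even_part_one)
  then show ?thesis by (simp only: mult_cancel_left) simp
qed

text \<open>Apply \<open>U\<close> to \<open>zeta_square\<close> times \<open>zeta ^ j\<close>. The
  factor \<xi>(q^2) leaves \<open>U\<close> as \<open>xi\<close>, which is the shift of the column
  index in the recurrence of M.\<close>

lemma even_part_zeta_rec:
  "even_part (zeta ^ Suc (Suc j)) = xi * (16 * even_part (zeta ^ Suc j) + even_part (zeta ^ j))"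
proof -
  have "zeta ^ Suc (Suc j) = zeta\<^sup>2 * zeta ^ j"
    by (simp add: power2_eq_square mult_ac)
  also have "\<dots> = (xi oo fps_X\<^sup>2) * (of_int 16 * zeta ^ Suc j + zeta ^ j)"
    unfolding zeta_square by (simp add: algebra_simps)
  finally show ?thesis
    by (simp only: even_part_compose_mult even_part_add even_part_of_int_mult) simp
qed

section \<open>The matrix M as the action of \<open>U\<close> on powers of
  \<open>zeta\<close>\<close>

lemma m_entry_0_right: "m_entry j 0 = 0"
  by (induction j "0::nat" rule: m_entry.induct) auto

text \<open>The zeros in column 0 extend the defining recurrence to k = 0, so that the first column
  needs no separate treatment.\<close>

lemma m_entry_rec:
  "m_entry (Suc (Suc (Suc j))) (Suc k) = 16 * m_entry (Suc (Suc j)) k + m_entry (Suc j) k"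
  by (cases k) (simp_all add: m_entry_0_right)

lemma m_entry_above: "j < k \<Longrightarrow> m_entry j k = 0"
  by (induction j k rule: m_entry.induct) auto

text \<open>Row j of M lists the coefficients of \<open>U\<close> of \<open>zeta ^ j\<close> in
  powers of \<open>xi\<close>. The free bound \<open>N\<close> lets both earlier rows be summed over
  the same range in the induction.\<close>

lemma even_part_zeta_power:
  assumes "Suc j \<le> N"
  shows "even_part (zeta ^ Suc j) = (\<Sum>k\<le>N. of_int (m_entry (Suc j) k) * xi ^ k)"
  using assms
proof (induction j arbitrary: N rule: less_induct)
  case (less j)
  consider "j = 0" | "j = 1" | i where "j = Suc (Suc i)"
    by (metis One_nat_def not0_implies_Suc)
  then show ?case
  proof cases
    case 1
    have "(\<Sum>k\<le>N. of_int (m_entry (Suc j) k) * xi ^ k) = (\<Sum>k\<in>{1}. of_int (m_entry (Suc j) k) * xi ^ k)"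
      using less.prems 1 by (intro sum.mono_neutral_right) auto
    then show ?thesis using 1 by (simp add: even_part_zeta)
  next
    case 2
    have "(\<Sum>k\<le>N. of_int (m_entry (Suc j) k) * xi ^ k) = (\<Sum>k\<in>{1,2}. of_int (m_entry (Suc j) k) * xi ^ k)"
      using less.prems 2 by (intro sum.mono_neutral_right) auto
    \<comment> \<open>Here the recurrence starts from \<open>zeta ^ 0 = 1\<close> and gives xi(16 *
      8 xi + 1), hence the entries 1 and 128.\<close>
    then show ?thesis using 2 even_part_zeta_rec[of 0]
      by (simp add: even_part_zeta even_part_one power2_eq_square algebra_simps)
  next
    case 3
    obtain M where N: "N = Suc M" using less.prems by (cases N) auto
    have "even_part (zeta ^ Suc j) = xi * (16 * (\<Sum>k\<le>M. of_int (m_entry (Suc (Suc i)) k) * xi ^ k) +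
        (\<Sum>k\<le>M. of_int (m_entry (Suc i) k) * xi ^ k))"
      unfolding 3 even_part_zeta_rec[of "Suc i"] using less.prems 3 N
      by (subst less.IH[of "Suc i" M] less.IH[of i M], simp, simp)+ simp
    also have "\<dots> = (\<Sum>k\<le>M. of_int (m_entry (Suc j) (Suc k)) * xi ^ Suc k)"
      unfolding 3 m_entry_rec
      by (simp add: sum_distrib_left sum.distrib[symmetric] algebra_simps)
    also have "\<dots> = (\<Sum>k\<le>N. of_int (m_entry (Suc j) k) * xi ^ k)"
      unfolding N by (subst sum.atMost_Suc_shift) (simp add: m_entry_0_right)
    finally show ?thesis .
  qed
qed

text \<open>Multiplication by \<xi>(q^2)^i turns \<open>F\<close> into a power of
  \<open>zeta\<close>, and becomes multiplication by \<open>xi ^ i\<close> outside \<open>U\<close>.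
  Row \<open>l\<close> vanishes in the columns up to i because 2i < l, so \<open>xi ^ i\<close> can
  be cancelled.\<close>

lemma even_part_shift:
  assumes "2 * i < l" "l \<le> i + N" "F * (xi oo fps_X\<^sup>2) ^ i = zeta ^ l"
  shows "even_part F = (\<Sum>j=1..N. of_int (m_entry l (i + j)) * xi ^ j)"
proof -
  obtain l' where l: "l = Suc l'" using assms(1) by (cases l) auto
  have "xi ^ i * even_part F = even_part ((xi ^ i oo fps_X\<^sup>2) * F)"
    by (rule even_part_compose_mult[symmetric])
  also have "\<dots> = even_part (zeta ^ l)"
    unfolding assms(3)[symmetric] by (simp add: fps_compose_ring mult.commute)
  also have "\<dots> = (\<Sum>k\<le>i + N. of_int (m_entry l k) * xi ^ k)"
    using assms(2) unfolding l by (rule even_part_zeta_power)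
  also have "\<dots> = (\<Sum>k=1 + i..N + i. of_int (m_entry l k) * xi ^ k)"
  proof (rule sum.mono_neutral_right)
    show "\<forall>k \<in> {..i + N} - {1 + i..N + i}. of_int (m_entry l k) * xi ^ k = 0"
    proof
      fix k assume "k \<in> {..i + N} - {1 + i..N + i}"
      then have "2 * k < l" using assms(1) by auto
      then show "of_int (m_entry l k) * xi ^ k = 0" by (simp add: m_entry_eq_0)
    qed
  qed auto
  also have "\<dots> = xi ^ i * (\<Sum>j=1..N. of_int (m_entry l (i + j)) * xi ^ j)"
    unfolding sum.shift_bounds_cl_nat_ivl sum_distrib_left
    by (rule sum.cong) (simp_all add: power_add add.commute mult_ac)
  finally show ?thesis using xi_nonzero by simp
qed

text \<open>The row 3i comes from \<open>xi_mult_xi2\<close>; an additional factor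
  \<open>zeta\<close> raises it to 3i + 1 in the next lemma.\<close>

lemma even_part_xi_power:
  assumes "i \<ge> 1" "2 * i \<le> N"
  shows "even_part (xi ^ i) = (\<Sum>j=1..N. of_int (m_entry (3 * i) (i + j)) * xi ^ j)"
proof (rule even_part_shift)
  show "xi ^ i * (xi oo fps_X\<^sup>2) ^ i = zeta ^ (3 * i)"
    unfolding power_mult xi_mult_xi2[symmetric] power_mult_distrib by (rule mult.commute)
qed (use assms in auto)

lemma even_part_zeta_mult_xi_power:
  assumes "i \<ge> 1" "2 * i + 1 \<le> N"
  shows "even_part (zeta * xi ^ i) = (\<Sum>j=1..N. of_int (m_entry (3 * i + 1) (i + j)) * xi ^ j)"
proof (rule even_part_shift)
  show "zeta * xi ^ i * (xi oo fps_X\<^sup>2) ^ i = zeta ^ (3 * i + 1)"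
    unfolding power_add power_mult xi_mult_xi2[symmetric] power_mult_distrib
    by (simp only: mult_ac power_one_right)
qed (use assms in auto)

lemma infsum_finite_support:
  fixes f :: "nat \<Rightarrow> int"
  assumes "\<And>i. i > N \<Longrightarrow> f i = 0"
  shows "(\<Sum>\<^sub>\<infinity>i\<in>{1..}. f i) = (\<Sum>i=1..N. f i)"
proof -
  have "(\<Sum>\<^sub>\<infinity>i\<in>{1..}. f i) = (\<Sum>\<^sub>\<infinity>i\<in>{1..N}. f i)"
    using assms by (intro infsum_cong_neutral) auto
  then show ?thesis by simp
qed

section \<open>Generating functions of \<open>p\<^sub>8\<close>\<close>

definition xsum :: "nat \<Rightarrow> nat \<Rightarrow> rat fps" where
  "xsum a N = (\<Sum>j=1..N. of_int (x_entry a j) * xi ^ j)"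

lemma x_entry_Suc:
  assumes "a \<ge> 1" "\<forall>i>N. x_entry a i = 0"
  shows "x_entry (Suc a) j =
    (\<Sum>i=1..N. x_entry a i * m_entry (if odd a then 3 * i else 3 * i + 1) (i + j))"
proof -
  obtain b where "a = Suc b" using assms(1) by (cases a) auto
  moreover have "(\<Sum>\<^sub>\<infinity>i\<in>{1..}. x_entry a i * g i) = (\<Sum>i=1..N. x_entry a i * g i)" for g
    using assms(2) by (intro infsum_finite_support) simp
  ultimately show ?thesis
    by (cases "odd a") (simp_all only: x_entry.simps if_True if_False not_False_eq_True)
qed

text \<open>A row of M ends at the diagonal, so i + j is at most 3i or 3i + 1. Starting from 1, the
  bounds run 1, 2, 5, 10, 21, which are the upper limits in the theorem.\<close>

lemma x_entry_Suc_above: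
  assumes "a \<ge> 1" "\<forall>i>N. x_entry a i = 0"
    and "j > (if odd a then 2 * N else 2 * N + 1)"
  shows "x_entry (Suc a) j = 0"
  unfolding x_entry_Suc[OF assms(1,2)]
proof (rule sum.neutral, rule ballI)
  fix i assume "i \<in> {1..N}"
  then have "(if odd a then 3 * i else 3 * i + 1) < i + j" using assms(3) by (auto split: if_splits)
  then show "x_entry a i * m_entry (if odd a then 3 * i else 3 * i + 1) (i + j) = 0"
    by (simp only: m_entry_above mult_zero_right)
qed

text \<open>By linearity it suffices to know \<open>U\<close> on each \<open>F * xi ^ i\<close>. The
  factor \<open>F\<close> is 1 for odd \<open>a\<close> and \<open>zeta\<close> for even
  \<open>a\<close>.\<close>

lemma xsum_Suc:
  assumes "a \<ge> 1" "\<forall>i>N. x_entry a i = 0"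
    and F: "\<And>i. i \<ge> 1 \<Longrightarrow> i \<le> N \<Longrightarrow>
      even_part (F * xi ^ i) =
        (\<Sum>j=1..M. of_int (m_entry (if odd a then 3 * i else 3 * i + 1) (i + j)) * xi ^ j)"
  shows "xsum (Suc a) M = even_part (F * xsum a N)"
proof -
  have "F * xsum a N = (\<Sum>i=1..N. of_int (x_entry a i) * (F * xi ^ i))"
    by (simp add: xsum_def sum_distrib_left mult_ac)
  then have "even_part (F * xsum a N) = (\<Sum>i=1..N. \<Sum>j=1..M.
      of_int (x_entry a i) * (of_int (m_entry (if odd a then 3 * i else 3 * i + 1) (i + j)) * xi ^ j))"
    by (simp add: even_part_sum even_part_of_int_mult F sum_distrib_left)
  also have "\<dots> = xsum (Suc a) M"
    unfolding xsum_def x_entry_Suc[OF assms(1,2)] of_int_sum sum_distrib_right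
    by (subst sum.swap) (simp add: mult.assoc)
  finally show ?thesis ..
qed

lemma xsum_Suc_odd:
  assumes "odd a" "\<forall>i>N. x_entry a i = 0"
  shows "xsum (Suc a) (2 * N) = even_part (xsum a N)"
proof -
  have "xsum (Suc a) (2 * N) = even_part (1 * xsum a N)"
  proof (rule xsum_Suc)
    fix i assume "i \<ge> 1" "i \<le> N"
    then show "even_part (1 * xi ^ i) = (\<Sum>j=1..2 * N.
        of_int (m_entry (if odd a then 3 * i else 3 * i + 1) (i + j)) * xi ^ j)"
      using assms(1) even_part_xi_power[of i "2 * N"] by simp
  qed (use assms odd_pos[of a] in auto)
  then show ?thesis by simp
qed

lemma xsum_Suc_even:
  assumes "even a" "a \<ge> 1" "\<forall>i>N. x_entry a i = 0"
  shows "xsum (Suc a) (2 * N + 1) = even_part (zeta * xsum a N)"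
proof (rule xsum_Suc)
  fix i assume "i \<ge> 1" "i \<le> N"
  then show "even_part (zeta * xi ^ i) = (\<Sum>j=1..2 * N + 1.
      of_int (m_entry (if odd a then 3 * i else 3 * i + 1) (i + j)) * xi ^ j)"
    using assms(1) even_part_zeta_mult_xi_power[of i "2 * N + 1"] by simp
qed (use assms in auto)

text \<open>The prefactor f_2^8 is f_1^8 at q^2, so it passes through \<open>U\<close> and becomes
  f_1^8.\<close>

lemma p8_step_odd:
  assumes "euler_f 2 ^ 8 * (fps_X * Abs_fps f) = xsum a N"
    and "odd a" "\<forall>i>N. x_entry a i = 0"
  shows "euler_f 1 ^ 8 * (fps_X * Abs_fps (\<lambda>n. f (2 * n + 1))) = xsum (Suc a) (2 * N)"
proof -
  have "xsum (Suc a) (2 * N) = even_part ((euler_f 1 ^ 8 oo fps_X\<^sup>2) * (fps_X * Abs_fps f))"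
    using euler_f_compose[of 1 2] unfolding xsum_Suc_odd[OF assms(2,3)] assms(1)[symmetric]
    by (simp add: fps_compose_ring)
  then show ?thesis
    unfolding even_part_compose_mult even_part_X_mult ..
qed

text \<open>Since \<open>zeta\<close> times f_1^8 is q f_4^8 and f_4 is f_2 at q^2, the factor
  \<open>zeta\<close> trades the prefactor f_1^8 for f_2^8 and supplies one more q.\<close>

lemma euler_f_even_part_zeta:
  "even_part (zeta * (euler_f 1 ^ 8 * G)) = euler_f 2 ^ 8 * even_part (fps_X * G)"
proof -
  have "zeta * (euler_f 1 ^ 8 * G) = (euler_f 2 ^ 8 oo fps_X\<^sup>2) * (fps_X * G)"
    using euler_f_compose[of 2 2] unfolding mult.assoc[symmetric] zeta_eq
    by (simp add: fps_compose_ring mult_ac)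
  then show ?thesis by (simp only: even_part_compose_mult)
qed

lemma p8_step_even:
  assumes "euler_f 1 ^ 8 * (fps_X * Abs_fps f) = xsum a N"
    and "even a" "a \<ge> 1" "\<forall>i>N. x_entry a i = 0"
  shows "euler_f 2 ^ 8 * (fps_X * Abs_fps (\<lambda>n. f (2 * n))) = xsum (Suc a) (2 * N + 1)"
  unfolding xsum_Suc_even[OF assms(2,3,4)] assms(1)[symmetric] euler_f_even_part_zeta
    even_part_X2_mult ..

text \<open>With G = 1 / f_1^8 in \<open>euler_f_even_part_zeta\<close> the left side is
  \<open>U\<close> of \<open>zeta\<close>, that is 8 \<open>xi\<close>; this is x_{1,1} = 8.\<close>

lemma p8_base: "euler_f 2 ^ 8 * (fps_X * Abs_fps (\<lambda>n. p8 (2 * n + 1))) = xsum 1 1"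
proof -
  have "Abs_fps p8 = 1 / euler_f 1 ^ 8"
    by (simp add: fps_eq_iff p8_def)
  then have "euler_f 1 ^ 8 * Abs_fps p8 = 1"
    using fps_divide_mult_cancel[OF euler_f_power_nth_0[of 1], of 1] by (simp add: mult.commute)
  then have "euler_f 2 ^ 8 * even_part (fps_X * Abs_fps p8) = 8 * xi"
    using euler_f_even_part_zeta[of "Abs_fps p8"] by (simp add: even_part_zeta)
  then show ?thesis by (simp add: even_part_X_mult xsum_def)
qed

section \<open>Arithmetic progressions and summation bounds\<close>

lemma four_power_mod_3:
  obtains t :: nat where "4 ^ a = 3 * t + 1"
proof -
  have "\<exists>t :: nat. 4 ^ a = 3 * t + 1"
  proof (induction a)
    case (Suc a)
    then obtain t :: nat where "4 ^ a = 3 * t + 1" by blast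
    then have "4 ^ Suc a = 3 * (4 * t + 1) + 1" by simp
    then show ?case by blast
  qed simp
  then show ?thesis using that by blast
qed

lemma p8_even_index:
  fixes a :: nat
  defines "N \<equiv> (4 ^ Suc a - 1) div 3"
  assumes "euler_f 2 ^ 8 * (fps_X * Abs_fps (\<lambda>n. p8 (2 ^ (2 * a + 1) * n + (2 ^ (2 * a + 1) + 1) div 3)))
      = xsum (2 * a + 1) N"
    and "\<forall>j>N. x_entry (2 * a + 1) j = 0"
  shows "euler_f 1 ^ 8 * (fps_X * Abs_fps (\<lambda>n. p8 (2 ^ (2 * a + 2) * n + (2 ^ (2 * a + 3) + 1) div 3)))
      = xsum (2 * a + 2) (2 * N)"
    and "\<forall>j>2 * N. x_entry (2 * a + 2) j = 0"
proof -
  obtain t :: nat where t: "4 ^ a = 3 * t + 1" by (rule four_power_mod_3)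
  \<comment> \<open>Replacing n by 2n + 1 adds 2^(2a+1) to the offset, and P + (P + 1)/3 = (4P +
    1)/3 for P = 2^(2a+1). Writing 4^a = 3t + 1 makes the divisions exact.\<close>
  have "2 ^ (2 * a + 1) * (2 * n + 1) + (2 ^ (2 * a + 1) + 1) div 3 =
      2 ^ (2 * a + 2) * n + (2 ^ (2 * a + 3) + 1) div (3 :: nat)" for n
    by (simp add: power_add power_mult t algebra_simps)
  moreover have "Suc (2 * a + 1) = 2 * a + 2" by simp
  moreover have odd: "odd (2 * a + 1)" by simp
  ultimately show "euler_f 1 ^ 8 * (fps_X * Abs_fps (\<lambda>n. p8 (2 ^ (2 * a + 2) * n + (2 ^ (2 * a + 3) + 1) div 3)))
      = xsum (2 * a + 2) (2 * N)"
    using p8_step_odd[OF assms(2) odd assms(3)] by (simp only:)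
  show "\<forall>j>2 * N. x_entry (2 * a + 2) j = 0"
    using x_entry_Suc_above[OF _ assms(3)] by simp
qed

lemma p8_odd_index:
  fixes a :: nat
  defines "N \<equiv> (4 ^ Suc a - 1) div 3"
  shows "euler_f 2 ^ 8 * (fps_X * Abs_fps (\<lambda>n. p8 (2 ^ (2 * a + 1) * n + (2 ^ (2 * a + 1) + 1) div 3)))
      = xsum (2 * a + 1) N" (is "?P a N")
    and "\<forall>j>N. x_entry (2 * a + 1) j = 0" (is "?Z a N")
proof -
  have "?P a ((4 ^ Suc a - 1) div 3) \<and> ?Z a ((4 ^ Suc a - 1) div 3)"
  proof (induction a)
    case 0
    show ?case using p8_base by simp
  next
    case (Suc a)
    define N where "N = (4 ^ Suc a - 1) div (3 :: nat)"
    obtain t :: nat where t: "4 ^ a = 3 * t + 1" by (rule four_power_mod_3)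
    \<comment> \<open>One double step takes the bound from N through 2N to 4N + 1.\<close>
    have N': "(4 ^ Suc (Suc a) - 1) div 3 = 2 * (2 * N) + 1"
      unfolding N_def power_Suc t by simp
    note IH = p8_even_index[OF Suc.IH[THEN conjunct1] Suc.IH[THEN conjunct2], folded N_def]
    have idx: "Suc (2 * a + 2) = 2 * Suc a + 1" by simp
    have even: "even (2 * a + 2)" and pos: "2 * a + 2 \<ge> 1" by simp_all
    \<comment> \<open>Replacing n by 2n doubles the modulus and keeps the offset.\<close>
    have "2 ^ (2 * a + 2) * (2 * n) + (2 ^ (2 * a + 3) + 1) div 3 =
        2 ^ (2 * Suc a + 1) * n + (2 ^ (2 * Suc a + 1) + 1) div (3 :: nat)" for n
      by (simp add: power_add)
    with p8_step_even[OF IH(1) even pos IH(2)] have "?P (Suc a) (2 * (2 * N) + 1)"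
      by (simp only: idx)
    moreover have "?Z (Suc a) (2 * (2 * N) + 1)"
      using x_entry_Suc_above[OF pos IH(2)] even by (simp only: idx if_False not_True_eq_False) blast
    ultimately show ?case unfolding N' ..
  qed
  then show "?P a N" "?Z a N" unfolding N_def by blast+
qed

lemma eq_inverse_euler_f_power_mult:
  assumes "k > 0" "euler_f k ^ n * F = G"
  shows "F = 1 / euler_f k ^ n * G"
proof -
  have "1 / euler_f k ^ n * G = (1 / euler_f k ^ n * euler_f k ^ n) * F"
    unfolding assms(2)[symmetric] by (simp only: mult_ac)
  also have "\<dots> = F"
    using fps_divide_mult_cancel[OF euler_f_power_nth_0[OF assms(1)]] by simp
  finally show ?thesis ..
qed

lemma xsum_eq:
  "xsum a N = (\<Sum>j=1..N. of_int (x_entry a j) * fps_X ^ j *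
      (euler_f 2 ^ (24 * j) / euler_f 1 ^ (24 * j)))"
  unfolding xsum_def xi_power by (simp add: mult.assoc)

theorem theorem3p2:
  fixes \<alpha> :: nat
  assumes "\<alpha> \<ge> 1"
  shows "fps_X * Abs_fps (\<lambda>n. p8 (2 ^ (2 * \<alpha> - 1) * n + (2 ^ (2 * \<alpha> - 1) + 1) div 3)) =
           1 / euler_f 2 ^ 8 *
           (\<Sum>j = 1..(4 ^ \<alpha> - 1) div 3. of_int (x_entry (2 * \<alpha> - 1) j) * fps_X ^ j *
              (euler_f 2 ^ (24 * j) / euler_f 1 ^ (24 * j)))
       \<and> fps_X * Abs_fps (\<lambda>n. p8 (2 ^ (2 * \<alpha>) * n + (2 ^ (2 * \<alpha> + 1) + 1) div 3)) =
           1 / euler_f 1 ^ 8 *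
           (\<Sum>j = 1..(2 * (4 ^ \<alpha> - 1)) div 3. of_int (x_entry (2 * \<alpha>) j) * fps_X ^ j *
              (euler_f 2 ^ (24 * j) / euler_f 1 ^ (24 * j)))"
proof -
  obtain a where a: "\<alpha> = Suc a" using assms by (cases \<alpha>) auto
  have idx: "2 * Suc a = 2 * a + 2" "2 * a + 2 - 1 = 2 * a + 1" "2 * a + 2 + 1 = 2 * a + 3"
    by simp_all
  obtain t :: nat where t: "4 ^ a = 3 * t + 1" by (rule four_power_mod_3)
  \<comment> \<open>Doubling before or after the integer division agrees because 3 divides 4^(a+1) -
    1.\<close>
  have N2: "2 * (4 ^ Suc a - 1) div 3 = 2 * ((4 ^ Suc a - 1) div 3 :: nat)"
    unfolding power_Suc t by simp
  note odd = p8_odd_index[of a]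
  note even = p8_even_index[OF odd]
  show ?thesis
    unfolding a idx N2 xsum_eq[symmetric]
    by (intro conjI eq_inverse_euler_f_power_mult[OF zero_less_numeral odd(1)]
        eq_inverse_euler_f_power_mult[OF zero_less_one even(1)])
qed

end
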